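(* Let $n$ be a positive integer, $\delta>0$, and $\nu\in\mathbb{C}$ with $\operatorname{Re}\nu<n$. Let $\mu$ be a positive Borel measure on $\mathbb{R}$ all of whose moments are finite and whose support contains at least $n+1$ points, and let $p_n$ be a real orthogonal polynomial of degree $n$ with respect to $\mu$. Let $f:\mathbb{R}\to\mathbb{C}$ be continuous and absolutely integrable with $f(x)=O(x^{\operatorname{Re}\nu-n-\varepsilon})$ as $x\to\infty$ for some $\varepsilon>0$, such that the integrals defining $g:=W_\delta^{\nu,n}[f]$ converge absolutely and $g$ is absolutely integrable. Let $F(\omega)$ and $G(\omega)$ be the Fourier transforms of $f$ and $g$, respectively. Then the transfer function $H_\delta^\nu(\omega)=G(\omega)/F(\omega)$ is given, for real $\omega\neq0$ (in the sense that $G(\omega)=H_\delta^\nu(\omega)F(\omega)$), by $$H_\delta^\nu(\omega)=\frac{k_n\,n!}{h_n\,\delta^n}(-1)^n(i\omega)^{\nu-n}\int_{\mathbb{R}}p_n(\xi)\,e^{-i\omega\delta\xi}\,d\mu(\xi)=\frac{k_n\,n!}{h_n}(i\omega)^{\nu}\int_{\mathbb{R}}p_n(\xi)\,\xi^n\sum_{k=0}^{\infty}\frac{(-i\omega\delta\xi)^k}{(k+n)!}\,d\mu(\xi).$$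
   Context: Orthogonality of $p_n$ means $\int_{\mathbb{R}}p_n q\,d\mu=0$ for every polynomial $q$ of degree $<n$. $k_n$ is the leading coefficient of $p_n$ and $h_n=\int_{\mathbb{R}}p_n(\xi)^2\,d\mu(\xi)$. Fourier transform: $F(\omega)=\frac{1}{\sqrt{2\pi}}\int_{-\infty}^\infty e^{i\omega x}f(x)\,dx$, and likewise for $G$. Powers: $z^\nu=e^{\nu\ln z}$ with $-\pi<\arg z<\pi$; in particular $(i\omega)^\nu=e^{\nu(\ln|\omega|+i\pi\,\mathrm{sgn}(\omega)/2)}$ for real $\omega\ne0$. Weyl fractional integral ($\operatorname{Re}\lambda>0$): $W^{-\lambda}[f](x)=\frac{1}{\Gamma(\lambda)}\int_x^\infty f(y)(y-x)^{\lambda-1}dy$. Approximate orthogonal derivative: $D_\delta^n[f](x)=\frac{k_n\,n!}{h_n}\frac{1}{\delta^n}\int_{\mathbb{R}}f(x+\delta\xi)\,p_n(\xi)\,d\mu(\xi)$. Approximate fractional orthogonal derivative ($\operatorname{Re}\nu<n$): $W_\delta^{\nu,n}[f](x)=(-1)^nD_\delta^n\big[W^{\nu-n}[f]\big](x)=(-1)^nW^{\nu-n}\big[D_\delta^n[f]\big](x)$. *)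

theory Defs
  imports "HOL-Probability.Probability" "HOL-Computational_Algebra.Polynomial"
    "HOL-Library.Landau_Symbols"
begin

definition measure_support :: "real measure \<Rightarrow> real set" where
  "measure_support M = {x. \<forall>U. open U \<longrightarrow> x \<in> U \<longrightarrow> emeasure M U > 0}"

text \<open>The zeroth moment is included, so a measure with finite moments is a finite measure.\<close>

definition finite_moments :: "real measure \<Rightarrow> bool" where
  "finite_moments M \<longleftrightarrow> (\<forall>k::nat. integrable M (\<lambda>x. x ^ k))"

definition orthogonal_poly :: "real measure \<Rightarrow> nat \<Rightarrow> real poly \<Rightarrow> bool" where
  "orthogonal_poly M n p \<longleftrightarrow>
     degree p = n \<and> (\<forall>q. degree q < n \<longrightarrow> (LINT x|M. poly p x * poly q x) = 0)"

definition poly_norm_sq :: "real measure \<Rightarrow> real poly \<Rightarrow> real" where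
  "poly_norm_sq M p = (LINT x|M. (poly p x)\<^sup>2)"

text \<open>The kernel is \<open>exp (i \<omega> x)\<close>, with a positive sign in the exponent.\<close>

definition fourier :: "(real \<Rightarrow> complex) \<Rightarrow> real \<Rightarrow> complex" where
  "fourier f \<omega> = of_real (1 / sqrt (2 * pi)) * (LINT x|lborel. exp (\<i> * of_real (\<omega> * x)) * f x)"

text \<open>\<open>weyl_integral l\<close> is the operator usually written \<open>W\<close> with exponent \<open>-l\<close>; it is meant
  for \<open>Re l > 0\<close>.\<close>

definition weyl_integrand :: "complex \<Rightarrow> (real \<Rightarrow> complex) \<Rightarrow> real \<Rightarrow> real \<Rightarrow> complex" where
  "weyl_integrand l f x y = f y * of_real (y - x) powr (l - 1)"

definition weyl_integral :: "complex \<Rightarrow> (real \<Rightarrow> complex) \<Rightarrow> real \<Rightarrow> complex" where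
  "weyl_integral l f x = 1 / Gamma l * (LINT y:{x<..}|lborel. weyl_integrand l f x y)"

definition orth_deriv ::
  "real measure \<Rightarrow> real poly \<Rightarrow> nat \<Rightarrow> real \<Rightarrow> (real \<Rightarrow> complex) \<Rightarrow> real \<Rightarrow> complex" where
  "orth_deriv M p n \<delta> f x =
     of_real (lead_coeff p * fact n / poly_norm_sq M p * (1 / \<delta> ^ n)) *
     (LINT \<xi>|M. f (x + \<delta> * \<xi>) * of_real (poly p \<xi>))"

text \<open>The order of the operators (Weyl integral first) is immaterial at every \<open>x\<close> where the
  double integral converges absolutely, by Fubini.\<close>

definition frac_orth_deriv ::
  "real measure \<Rightarrow> real poly \<Rightarrow> nat \<Rightarrow> real \<Rightarrow> complex \<Rightarrow> (real \<Rightarrow> complex) \<Rightarrow> real \<Rightarrow> complex" where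
  "frac_orth_deriv M p n \<delta> \<nu> f x =
     (-1) ^ n * orth_deriv M p n \<delta> (weyl_integral (of_nat n - \<nu>) f) x"

text \<open>Absolute convergence, at every point, of the two integrals occurring in
  \<^const>\<open>frac_orth_deriv\<close>.\<close>

definition frac_orth_deriv_converges ::
  "real measure \<Rightarrow> real poly \<Rightarrow> nat \<Rightarrow> real \<Rightarrow> complex \<Rightarrow> (real \<Rightarrow> complex) \<Rightarrow> bool" where
  "frac_orth_deriv_converges M p n \<delta> \<nu> f \<longleftrightarrow>
     (\<forall>x. set_integrable lborel {x<..} (weyl_integrand (of_nat n - \<nu>) f x)) \<and>
     (\<forall>x. integrable M (\<lambda>\<xi>. weyl_integral (of_nat n - \<nu>) f (x + \<delta> * \<xi>) * of_real (poly p \<xi>)))"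

end

theory Submission
  imports Defs "HOL-Complex_Analysis.Conformal_Mappings"
begin

text \<open>The Weyl integral of \<open>f\<close> is the correlation of \<open>f\<close> with the kernel \<open>u powr (l - 1)\<close> on the
  positive half line, \<open>l = n - \<nu>\<close>. Neither the kernel nor the Weyl integral need be integrable, so
  Fubini does not apply directly. Taking \<open>K > Re l\<close> finite differences of step \<open>h\<close> cures this: the
  differenced kernel is integrable, since it decays like \<open>u powr (Re l - 1 - K)\<close>. Its Fourier
  transform is the limit on the imaginary axis of its Laplace transform, which is
  \<open>(exp (- z * h) - 1) ^ K * Gamma l * z powr (- l)\<close>. Differencing commutes with both the Weyl integral
  and the approximate derivative and multiplies the Fourier transform of \<open>g\<close> by
  \<open>(exp (- \<i> * \<omega> * h) - 1) ^ K\<close>. For \<open>h = pi / \<bar>\<omega>\<bar>\<close> this factor is \<open>(- 2) ^ K\<close> and cancels.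
  The second form of the transfer function follows because \<open>p\<close> is orthogonal to the first \<open>n\<close> terms
  of the exponential series.\<close>

section \<open>Iterated differences\<close>

text \<open>The difference is applied to the function before the recursive call, so inductions on
  \<open>K\<close> have to generalise over \<open>\<phi>\<close>. A negative step is allowed:
  \<open>- h\<close> gives differences \<open>\<phi> (u + h) - \<phi> u\<close>.\<close>

primrec fdiff :: "real \<Rightarrow> nat \<Rightarrow> (real \<Rightarrow> complex) \<Rightarrow> real \<Rightarrow> complex" where
  "fdiff h 0 \<phi> = \<phi>"
| "fdiff h (Suc K) \<phi> = fdiff h K (\<lambda>u. \<phi> (u - h) - \<phi> u)"

lemma fdiff_mult_right: "fdiff h K (\<lambda>x. \<phi> x * c) x = fdiff h K \<phi> x * c"
proof (induction K arbitrary: \<phi>)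
  case (Suc K)
  show ?case
    using Suc.IH[of "\<lambda>u. \<phi> (u - h) - \<phi> u"] by (simp add: left_diff_distrib)
qed simp

lemma fdiff_mult_left: "fdiff h K (\<lambda>x. c * \<phi> x) x = c * fdiff h K \<phi> x"
  using fdiff_mult_right[of h K \<phi> c x] by (simp add: mult.commute)

lemma fdiff_translate: "fdiff h K (\<lambda>x. \<phi> (x + b)) x = fdiff h K \<phi> (x + b)"
proof (induction K arbitrary: \<phi>)
  case (Suc K)
  show ?case
    using Suc.IH[of "\<lambda>u. \<phi> (u - h) - \<phi> u"] by (simp add: add_diff_eq diff_add_eq)
qed simp

text \<open>Reflection reverses the direction of the step. This carries differences in
  \<open>x\<close> over to a kernel that depends on \<open>y - x\<close>.\<close>

lemma fdiff_reflect: "fdiff (- h) K (\<lambda>x. \<phi> (y - x)) x = fdiff h K \<phi> (y - x)"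
proof (induction K arbitrary: \<phi>)
  case (Suc K)
  show ?case
    using Suc.IH[of "\<lambda>u. \<phi> (u - h) - \<phi> u"] by (simp add: diff_diff_eq)
qed simp

text \<open>An iterated difference is a finite linear combination of translates, so linearity of the
  integral is enough. Integrability is assumed at every \<open>x\<close> because the translates
  sample other points.\<close>

lemma fdiff_integral:
  assumes "\<And>x. integrable N (F x)"
  shows integrable_fdiff: "integrable N (\<lambda>u. fdiff h K (\<lambda>x. F x u) x)"
    and fdiff_integral_eq: "fdiff h K (\<lambda>x. LINT u|N. F x u) x = (LINT u|N. fdiff h K (\<lambda>x. F x u) x)"
proof -
  have "integrable N (\<lambda>u. fdiff h K (\<lambda>x. F x u) x) \<and>
        fdiff h K (\<lambda>x. LINT u|N. F x u) x = (LINT u|N. fdiff h K (\<lambda>x. F x u) x)"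
    using assms
  proof (induction K arbitrary: F)
    case (Suc K)
    then show ?case
      using Suc.IH[of "\<lambda>x u. F (x - h) u - F x u"] by simp
  qed simp
  then show "integrable N (\<lambda>u. fdiff h K (\<lambda>x. F x u) x)"
    and "fdiff h K (\<lambda>x. LINT u|N. F x u) x = (LINT u|N. fdiff h K (\<lambda>x. F x u) x)" by auto
qed

text \<open>Translating \<open>\<phi>\<close> by \<open>h\<close> multiplies its exponential
  integral by \<open>exp (a * h)\<close>, so each difference contributes one factor. Complex
  \<open>a\<close> covers Laplace and Fourier transforms at once.\<close>

lemma fdiff_exp_integral:
  fixes a :: complex
  assumes "integrable lborel (\<lambda>u. \<phi> u * exp (a * of_real u))"
  shows integrable_fdiff_exp: "integrable lborel (\<lambda>u. fdiff h K \<phi> u * exp (a * of_real u))"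
    and fdiff_exp_integral_eq: "(LINT u|lborel. fdiff h K \<phi> u * exp (a * of_real u)) =
      (exp (a * of_real h) - 1) ^ K * (LINT u|lborel. \<phi> u * exp (a * of_real u))"
proof -
  have "integrable lborel (\<lambda>u. fdiff h K \<phi> u * exp (a * of_real u)) \<and>
    (LINT u|lborel. fdiff h K \<phi> u * exp (a * of_real u)) =
      (exp (a * of_real h) - 1) ^ K * (LINT u|lborel. \<phi> u * exp (a * of_real u))"
    using assms
  proof (induction K arbitrary: \<phi>)
    case (Suc K)
    let ?e = "\<lambda>u. \<phi> u * exp (a * of_real u)"
    have shift: "\<phi> (u - h) * exp (a * of_real u) = exp (a * of_real h) * ?e (- h + 1 * u)" for u
      by (simp add: exp_add[symmetric] algebra_simps)
    have int: "integrable lborel (\<lambda>u. \<phi> (u - h) * exp (a * of_real u))"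
      unfolding shift using lborel_integrable_real_affine[OF Suc.prems, of 1 "- h"] by simp
    have "(LINT u|lborel. \<phi> (u - h) * exp (a * of_real u)) =
        exp (a * of_real h) * (LINT u|lborel. ?e u)"
      unfolding shift by (subst lborel_integral_real_affine[of 1 ?e "- h"]) simp_all
    then show ?case
      using Suc.IH[of "\<lambda>u. \<phi> (u - h) - \<phi> u"] int Suc.prems
      by (simp add: left_diff_distrib algebra_simps)
  qed simp
  then show "integrable lborel (\<lambda>u. fdiff h K \<phi> u * exp (a * of_real u))"
    and "(LINT u|lborel. fdiff h K \<phi> u * exp (a * of_real u)) =
      (exp (a * of_real h) - 1) ^ K * (LINT u|lborel. \<phi> u * exp (a * of_real u))" by auto
qed

text \<open>\<open>D j\<close> plays the role of the \<open>j\<close>-th derivative of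
  \<open>D 0\<close>. By the mean value inequality each difference trades one derivative for a
  factor \<open>h\<close>, and it moves the left end of the domain from \<open>c\<close> to
  \<open>c + h\<close>.\<close>

lemma norm_fdiff_le:
  fixes D :: "nat \<Rightarrow> real \<Rightarrow> complex"
  assumes "h \<ge> 0"
    and "\<And>j u. u > c \<Longrightarrow> (D j has_vector_derivative D (Suc j) u) (at u)"
    and "\<And>u. u > c \<Longrightarrow> norm (D K u) \<le> B"
    and "u > c + K * h"
  shows "norm (fdiff h K (D 0) u) \<le> h ^ K * B"
  using assms(2-)
proof (induction K arbitrary: D c B)
  case (Suc K)
  let ?E = "\<lambda>j u. D j (u - h) - D j u"
  have "norm (fdiff h K (?E 0) u) \<le> h ^ K * (h * B)"
  proof (rule Suc.IH[where c = "c + h"])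
    fix j v assume v: "v > c + h"
    show "(?E j has_vector_derivative ?E (Suc j) v) (at v)"
      using v \<open>h \<ge> 0\<close>
      by (auto intro!: derivative_eq_intros Suc.prems(1)
          vector_diff_chain_at[of "\<lambda>u. u - h" 1 v "D j", unfolded o_def, simplified])
  next
    fix v assume v: "v > c + h"
    have "norm (D K (v - h) - D K v) \<le> B * norm ((v - h) - v)"
    proof (rule differentiable_bound[of "{c<..}"])
      fix x assume x: "x \<in> {c<..}"
      then show "(D K has_derivative (\<lambda>r. r *\<^sub>R D (Suc K) x)) (at x within {c<..})"
        using Suc.prems(1) by (auto simp: has_vector_derivative_def intro: has_derivative_at_withinI)
      show "onorm (\<lambda>r. r *\<^sub>R D (Suc K) x) \<le> B"
        using Suc.prems(2)[of x] x by (intro onorm_le) (auto simp: mult.commute[of B] intro: mult_left_mono)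
    qed (use v \<open>h \<ge> 0\<close> in auto)
    then show "norm (?E K v) \<le> h * B"
      using \<open>h \<ge> 0\<close> by (simp add: mult.commute)
  next
    show "u > c + h + K * h"
      using Suc.prems(3) by (simp add: algebra_simps)
  qed
  then show ?case by (simp add: mult_ac)
qed simp

section \<open>The one-sided power kernel\<close>

text \<open>Extension by zero turns the Weyl integral over \<open>y > x\<close> into an integral
  over the whole line against \<open>pos_kernel l (y - x)\<close>.\<close>

definition pos_kernel :: "complex \<Rightarrow> real \<Rightarrow> complex" where
  "pos_kernel l u = (if u > 0 then of_real u powr (l - 1) else 0)"

lemma norm_pos_kernel: "norm (pos_kernel l u) = (if u > 0 then u powr (Re l - 1) else 0)"
  by (simp add: pos_kernel_def norm_powr_real_powr)

lemma borel_measurable_pos_kernel [measurable]: "pos_kernel l \<in> borel_measurable borel"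
proof -
  have "(\<lambda>u::real. indicator {0<..} u *\<^sub>R (complex_of_real u powr (l - 1))) \<in> borel_measurable borel"
    by (intro borel_measurable_continuous_on_indicator continuous_intros)
       (auto simp: complex_nonpos_Reals_iff)
  also have "(\<lambda>u::real. indicator {0<..} u *\<^sub>R (complex_of_real u powr (l - 1))) = pos_kernel l"
    by (auto simp: pos_kernel_def fun_eq_iff)
  finally show ?thesis .
qed

section \<open>Laplace transform of the kernel on the right half plane\<close>

text \<open>The integrand has the same modulus as the Gamma integrand with the real decay rate
  \<open>Re z\<close>.\<close>

lemma integrable_pos_kernel_exp:
  assumes "Re l > 0" "Re z > 0"
  shows "integrable lborel (\<lambda>u. pos_kernel l u * exp (- z * of_real u))"
proof -
  have "integrable lebesgue (\<lambda>t. indicator {0<..} t *\<^sub>R (complex_of_real t powr (l - 1) / of_real (exp (Re z * t))))"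
    using absolutely_integrable_Gamma_integral[OF assms] by (simp add: set_integrable_def)
  also have "(\<lambda>t. indicator {0<..} t *\<^sub>R (complex_of_real t powr (l - 1) / of_real (exp (Re z * t))))
      = (\<lambda>t. pos_kernel l t * of_real (exp (- Re z * t)))"
    by (auto simp: pos_kernel_def fun_eq_iff exp_minus divide_simps)
  \<comment> \<open>The Gamma integral lives on the completed measure; for a Borel integrand
    integrability passes to \<open>lborel\<close>.\<close>
  finally have "integrable lborel (\<lambda>t. pos_kernel l t * of_real (exp (- Re z * t)))"
    by (subst (asm) integrable_completion) auto
  then show ?thesis
    by (rule Bochner_Integration.integrable_bound) (auto simp: norm_mult)
qed

text \<open>This is Euler's integral for \<open>Gamma l\<close> after the substitution of
  \<open>s * u\<close> for \<open>u\<close>, which is real only for real \<open>s\<close>; complex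
  arguments need another argument.\<close>

lemma laplace_pos_kernel_real:
  assumes "Re l > 0" and "s > 0"
  shows "(LINT u|lborel. pos_kernel l u * exp (- complex_of_real s * of_real u)) =
    Gamma l * of_real s powr (- l)"
proof -
  let ?\<phi> = "\<lambda>u. pos_kernel l u * exp (- 1 * of_real u)"
  have eq: "(\<lambda>t. indicator {0<..} t *\<^sub>R (complex_of_real t powr (l - 1) / of_real (exp t))) = ?\<phi>"
    by (auto simp: pos_kernel_def fun_eq_iff exp_minus exp_of_real divide_simps)
  have "(LINT t:{0<..}|lebesgue. complex_of_real t powr (l - 1) / of_real (exp t)) = Gamma l"
    using absolutely_integrable_Gamma_integral'[OF assms(1)] Gamma_integral_complex'[OF assms(1)]
    by (simp add: set_lebesgue_integral_eq_integral(2) integral_unique)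
  then have "Gamma l = (LINT u|lborel. ?\<phi> u)"
    unfolding set_lebesgue_integral_def eq by (subst (asm) integral_completion) auto
  also have "\<dots> = s *\<^sub>R (LINT u|lborel. ?\<phi> (0 + s * u))"
    using assms(2) by (subst lborel_integral_real_affine[of s _ 0]) auto
  also have "(\<lambda>u. ?\<phi> (0 + s * u)) =
      (\<lambda>u. of_real s powr (l - 1) * (pos_kernel l u * exp (- complex_of_real s * of_real u)))"
    using assms(2) by (auto simp: fun_eq_iff pos_kernel_def powr_times_real zero_less_mult_iff)
  also have "s *\<^sub>R (LINT u|lborel. \<dots> u) =
      of_real s powr l * (LINT u|lborel. pos_kernel l u * exp (- complex_of_real s * of_real u))"
    using assms(2) by (simp add: powr_diff scaleR_conv_of_real)
  finally show ?thesis
    using assms(2) by (simp add: powr_minus field_simps)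
qed

text \<open>Differentiation under the integral sign, by dominated convergence of the difference
  quotients along sequences tending to \<open>z\<close>.\<close>

lemma laplace_pos_kernel_deriv:
  assumes "Re l > 0" and "Re z > 0"
  shows "((\<lambda>z. LINT u|lborel. pos_kernel l u * exp (- z * of_real u)) has_field_derivative
     (LINT u|lborel. pos_kernel l u * (- of_real u * exp (- z * of_real u)))) (at z)"
proof -
  \<comment> \<open>Half of \<open>Re z\<close> leaves an open convex half plane around
    \<open>z\<close> on which the exponentials decay at the uniform rate \<open>c\<close>.\<close>
  define c where "c = Re z / 2"
  define S where "S = {w. Re w > c}"
  have c: "c > 0" "z \<in> S"
    using assms(2) by (auto simp: S_def c_def)
  have S: "open S" "convex S"
    by (auto simp: S_def open_halfspace_Re_gt convex_halfspace_Re_gt)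
  have int: "integrable lborel (\<lambda>u. pos_kernel l u * exp (- w * of_real u))" if "w \<in> S" for w
    using that c by (intro integrable_pos_kernel_exp assms) (auto simp: S_def)
  let ?L = "\<lambda>z. LINT u|lborel. pos_kernel l u * exp (- z * of_real u)"
  let ?q = "\<lambda>w u. (exp (- w * of_real u) - exp (- z * of_real u)) / (w - z)"
  have "((\<lambda>w. (?L w - ?L z) / (w - z)) \<longlongrightarrow>
      (LINT u|lborel. pos_kernel l u * (- of_real u * exp (- z * of_real u)))) (at z within S)"
    unfolding tendsto_at_iff_sequentially o_def
  proof (intro allI impI)
    fix X assume X: "\<forall>i. X i \<in> S - {z}" "X \<longlonglongrightarrow> z"
    \<comment> \<open>The derivative in \<open>w\<close> brings down a factor \<open>u\<close>,
      which raises the exponent of the kernel by one. Hence the dominating function is built from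
      \<open>pos_kernel (l + 1)\<close>.\<close>
    have "(\<lambda>i. LINT u|lborel. pos_kernel l u * ?q (X i) u) \<longlonglongrightarrow>
        (LINT u|lborel. pos_kernel l u * (- of_real u * exp (- z * of_real u)))"
    proof (rule integral_dominated_convergence[where w = "\<lambda>u. norm (pos_kernel (l + 1) u * exp (- of_real c * of_real u))"])
      show "integrable lborel (\<lambda>u. norm (pos_kernel (l + 1) u * exp (- of_real c * of_real u)))"
        using assms c by (intro integrable_norm integrable_pos_kernel_exp) auto
      show "AE u in lborel. (\<lambda>i. pos_kernel l u * ?q (X i) u) \<longlonglongrightarrow>
          pos_kernel l u * (- of_real u * exp (- z * of_real u))"
      proof (rule AE_I2)
        fix u :: real
        have "((\<lambda>w. exp (- w * of_real u)) has_field_derivative - of_real u * exp (- z * of_real u)) (at z within S)"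
          by (auto intro!: derivative_eq_intros)
        then have "((\<lambda>w. ?q w u) \<longlongrightarrow> - of_real u * exp (- z * of_real u)) (at z within S)"
          by (simp add: has_field_derivative_iff)
        then have "(\<lambda>i. ?q (X i) u) \<longlonglongrightarrow> - of_real u * exp (- z * of_real u)"
          using X unfolding tendsto_at_iff_sequentially o_def by blast
        then show "(\<lambda>i. pos_kernel l u * ?q (X i) u) \<longlonglongrightarrow>
          pos_kernel l u * (- of_real u * exp (- z * of_real u))"
          by (intro tendsto_mult tendsto_const)
      qed
      show "AE u in lborel. norm (pos_kernel l u * ?q (X i) u)
          \<le> norm (pos_kernel (l + 1) u * exp (- of_real c * of_real u))" for i
      proof (rule AE_I2)
        fix u :: real
        show "norm (pos_kernel l u * ?q (X i) u)
          \<le> norm (pos_kernel (l + 1) u * exp (- of_real c * of_real u))"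
        proof (cases "u > 0")
          case True
          have "norm (exp (- X i * of_real u) - exp (- z * of_real u)) \<le> (u * exp (- c * u)) * norm (X i - z)"
          proof (rule field_differentiable_bound[OF S(2)])
            fix w assume w: "w \<in> S"
            show "((\<lambda>w. exp (- w * of_real u)) has_field_derivative - of_real u * exp (- w * of_real u)) (at w within S)"
              by (auto intro!: derivative_eq_intros)
            show "norm (- of_real u * exp (- w * of_real u)) \<le> u * exp (- c * u)"
              using True w by (simp add: norm_mult S_def)
          qed (use X c in auto)
          moreover have "norm (X i - z) > 0" using X by auto
          ultimately have "norm (?q (X i) u) \<le> u * exp (- c * u)"
            by (simp add: norm_divide divide_simps)
          then have "norm (pos_kernel l u * ?q (X i) u) \<le> u powr (Re l - 1) * (u * exp (- c * u))"
            unfolding norm_mult norm_pos_kernel using True by (auto intro: mult_left_mono)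
          also have "\<dots> = u powr Re l * exp (- c * u)"
            using True by (simp add: powr_diff)
          finally show ?thesis
            using True by (simp add: norm_mult norm_pos_kernel)
        qed (simp add: pos_kernel_def)
      qed
    qed auto
    moreover have "(LINT u|lborel. pos_kernel l u * ?q (X i) u) = (?L (X i) - ?L z) / (X i - z)" for i
    proof -
      have "pos_kernel l u * ?q (X i) u =
        (pos_kernel l u * exp (- X i * of_real u) - pos_kernel l u * exp (- z * of_real u)) / (X i - z)" for u
        by (simp add: right_diff_distrib)
      then show ?thesis
        using int[of "X i"] int[of z] X c by simp
    qed
    ultimately show "(\<lambda>i. (?L (X i) - ?L z) / (X i - z)) \<longlonglongrightarrow>
        (LINT u|lborel. pos_kernel l u * (- of_real u * exp (- z * of_real u)))"
      by (simp only:)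
  qed
  then show ?thesis
    using at_within_open[OF c(2) S(1)] by (simp add: has_field_derivative_iff)
qed

text \<open>Both sides are holomorphic on the connected right half plane and agree on the positive
  reals, which accumulate at 1; the identity theorem does the rest.\<close>

lemma laplace_pos_kernel:
  assumes "Re l > 0" and "Re z > 0"
  shows "(LINT u|lborel. pos_kernel l u * exp (- z * of_real u)) = Gamma l * z powr (- l)"
proof -
  let ?f = "\<lambda>z. (LINT u|lborel. pos_kernel l u * exp (- z * of_real u)) - Gamma l * z powr (- l)"
  have "?f z = 0"
  proof (rule analytic_continuation[where f = ?f and S = "{z. Re z > 0}" and U = "of_real ` {0<..}" and \<xi> = 1])
    have "(\<lambda>z. LINT u|lborel. pos_kernel l u * exp (- z * of_real u)) holomorphic_on {z. Re z > 0}"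
      using laplace_pos_kernel_deriv[OF assms(1)]
      by (subst holomorphic_on_open) (auto simp: open_halfspace_Re_gt)
    then show "?f holomorphic_on {z. Re z > 0}"
      by (intro holomorphic_intros) (auto simp: complex_nonpos_Reals_iff)
    show "(1::complex) islimpt of_real ` {0<..}"
      unfolding islimpt_approachable
    proof (intro allI impI)
      fix e :: real assume "e > 0"
      then show "\<exists>x'\<in>complex_of_real ` {0<..}. x' \<noteq> 1 \<and> dist x' 1 < e"
        by (intro bexI[OF _ imageI[of "1 + e / 2"]]) (auto simp: dist_norm norm_divide)
    qed
  qed (use assms laplace_pos_kernel_real in \<open>auto simp: open_halfspace_Re_gt convex_connected convex_halfspace_Re_gt\<close>)
  then show ?thesis by simp
qed

section \<open>Decay, integrability and Fourier transform of the differenced kernel\<close>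

lemma pos_kernel_has_vector_derivative:
  assumes "u > 0"
  shows "(pos_kernel l has_vector_derivative (l - 1) * pos_kernel (l - 1) u) (at u)"
proof -
  have "((\<lambda>v. complex_of_real v powr (l - 1)) has_vector_derivative
      (l - 1) * of_real u powr (l - 1 - 1)) (at u)"
    using assms by (intro has_vector_derivative_real_field has_field_derivative_powr)
      (auto simp: complex_nonpos_Reals_iff)
  then have "(pos_kernel l has_vector_derivative (l - 1) * of_real u powr (l - 1 - 1)) (at u)"
    by (rule has_vector_derivative_transform_within_open[of _ _ _ "{0<..}"])
       (use assms in \<open>auto simp: pos_kernel_def\<close>)
  then show ?thesis
    using assms by (simp add: pos_kernel_def)
qed

text \<open>The \<open>K\<close>-th derivative of the kernel is a constant multiple of
  \<open>pos_kernel (l - K)\<close>, and \<open>norm_fdiff_le\<close> turns its decay into decay of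
  the differences.\<close>

lemma norm_fdiff_pos_kernel_le:
  assumes "h \<ge> 0" "Re l \<le> real K" "u > K * h"
  shows "norm (fdiff h K (pos_kernel l) u) \<le>
    h ^ K * norm (\<Prod>i<K. l - 1 - of_nat i) * ((u - K * h) / 2) powr (Re l - 1 - K)"
proof -
  let ?D = "\<lambda>j u. (\<Prod>i<j. l - 1 - of_nat i) * pos_kernel (l - of_nat j) u"
  \<comment> \<open>Halving keeps \<open>c\<close> positive, hence away from the singularity at 0,
    while \<open>u > c + K * h\<close> still holds.\<close>
  define c where "c = (u - K * h) / 2"
  have c: "c > 0" "u > c + K * h"
    using assms(3) by (auto simp: c_def field_simps)
  have "norm (fdiff h K (?D 0) u) \<le> h ^ K * (norm (\<Prod>i<K. l - 1 - of_nat i) * c powr (Re l - 1 - K))"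
  proof (rule norm_fdiff_le[OF assms(1) _ _ c(2)])
    fix j v assume "v > c"
    then have "v > 0" using c by simp
    have D: "?D (Suc j) v = (\<Prod>i<j. l - 1 - of_nat i) *
        ((l - of_nat j - 1) * pos_kernel (l - of_nat j - 1) v)"
      by (simp add: diff_diff_eq add.commute)
    show "(?D j has_vector_derivative ?D (Suc j) v) (at v)"
      unfolding D by (intro has_vector_derivative_mult_right pos_kernel_has_vector_derivative \<open>v > 0\<close>)
  next
    fix v assume v: "v > c"
    \<comment> \<open>The exponent is negative, so the power is largest at the left end
      \<open>c\<close>.\<close>
    then have "v powr (Re l - 1 - K) \<le> c powr (Re l - 1 - K)"
      using c assms(2) by (intro powr_mono2') auto
    then have "norm (\<Prod>i<K. l - 1 - of_nat i) * v powr (Re l - 1 - K) \<le>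
        norm (\<Prod>i<K. l - 1 - of_nat i) * c powr (Re l - 1 - K)"
      by (intro mult_left_mono) auto
    then show "norm (?D K v) \<le> norm (\<Prod>i<K. l - 1 - of_nat i) * c powr (Re l - 1 - K)"
      unfolding norm_mult norm_pos_kernel using v c by (simp add: cancel_ab_semigroup_add_class.diff_right_commute[of "Re l" "real K" 1])
  qed
  then show ?thesis by (simp add: c_def mult_ac)
qed

text \<open>The tail \<open>u \<ge> A\<close> is controlled by a power with exponent below -1. For
  \<open>u < A\<close> the weight \<open>exp (- u)\<close> is bounded below by
  \<open>exp (- A)\<close>, so integrability of the weighted function suffices, including near
  singularities.\<close>

lemma integrable_fdiff_pos_kernel:
  assumes "Re l > 0" "h \<ge> 0" "Re l < real K"
  shows "integrable lborel (fdiff h K (pos_kernel l))"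
proof -
  let ?\<kappa> = "fdiff h K (pos_kernel l)"
  \<comment> \<open>Beyond \<open>A\<close> the base \<open>(u - K * h) / 2\<close> of the power is
    at least 1/2, away from 0.\<close>
  define A where "A = K * h + 1"
  have int: "integrable lborel (\<lambda>u. ?\<kappa> u * exp (- 1 * of_real u))"
    by (intro integrable_fdiff_exp integrable_pos_kernel_exp assms) auto
  \<comment> \<open>Measurability is read off from the weighted function by multiplying the weight
    away.\<close>
  have "(\<lambda>u. (?\<kappa> u * exp (- 1 * of_real u)) * exp (of_real u)) \<in> borel_measurable lborel"
    by (rule borel_measurable_times[OF borel_measurable_integrable[OF int]]) auto
  then have [measurable]: "?\<kappa> \<in> borel_measurable borel"
    by (simp add: mult.assoc exp_add[symmetric])
  let ?C = "h ^ K * norm (\<Prod>i<K. l - 1 - of_nat i)"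
  let ?e = "Re l - 1 - K"
  have e: "?e < -1" using assms by simp
  have "(\<lambda>v. v powr ?e) absolutely_integrable_on {1/2..}"
    using has_integral_powr_to_inf[OF e, of "1/2"]
    by (intro nonnegative_absolutely_integrable_1) (auto simp: integrable_on_def)
  then have "integrable lborel (\<lambda>v. indicator {1/2..} v *\<^sub>R v powr ?e)"
    unfolding set_integrable_def by (subst (asm) integrable_completion) auto
  from lborel_integrable_real_affine[OF this, of "1/2" "- (K * h) / 2"]
  have int2: "integrable lborel (\<lambda>u. indicator {1/2..} ((u - K * h) / 2) *\<^sub>R ((u - K * h) / 2) powr ?e)"
    by (simp add: diff_divide_distrib)
  have "integrable lborel (\<lambda>u. exp A * norm (?\<kappa> u * exp (- 1 * of_real u)) +
     ?C * (indicator {1/2..} ((u - K * h) / 2) *\<^sub>R ((u - K * h) / 2) powr ?e))"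
    using int int2 by (intro Bochner_Integration.integrable_add integrable_mult_right integrable_norm) auto
  then show ?thesis
  proof (rule Bochner_Integration.integrable_bound)
    show "AE u in lborel. norm (?\<kappa> u) \<le> norm (exp A * norm (?\<kappa> u * exp (- 1 * of_real u)) +
     ?C * (indicator {1/2..} ((u - K * h) / 2) *\<^sub>R ((u - K * h) / 2) powr ?e))"
    proof (rule AE_I2)
      fix u
      have nn: "0 \<le> exp A * norm (?\<kappa> u * exp (- 1 * of_real u))"
        "0 \<le> ?C * (indicator {1/2..} ((u - K * h) / 2) *\<^sub>R ((u - K * h) / 2) powr ?e)"
        using assms by auto
      have "norm (?\<kappa> u) \<le> exp A * norm (?\<kappa> u * exp (- 1 * of_real u)) +
     ?C * (indicator {1/2..} ((u - K * h) / 2) *\<^sub>R ((u - K * h) / 2) powr ?e)"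
      proof (cases "u \<ge> A")
        case True
        then have "norm (?\<kappa> u) \<le> ?C * (indicator {1/2..} ((u - K * h) / 2) *\<^sub>R ((u - K * h) / 2) powr ?e)"
          using norm_fdiff_pos_kernel_le[of h l K u] assms by (simp add: A_def)
        then show ?thesis using nn by linarith
      next
        case False
        then have "1 * norm (?\<kappa> u) \<le> exp (A - u) * norm (?\<kappa> u)"
          by (intro mult_right_mono) auto
        also have "\<dots> = exp A * norm (?\<kappa> u * exp (- 1 * of_real u))"
          by (simp add: norm_mult norm_divide exp_diff exp_minus divide_simps)
        finally show ?thesis using nn by linarith
      qed
      then show "norm (?\<kappa> u) \<le> norm (exp A * norm (?\<kappa> u * exp (- 1 * of_real u)) +
     ?C * (indicator {1/2..} ((u - K * h) / 2) *\<^sub>R ((u - K * h) / 2) powr ?e))"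
        by simp
    qed
  qed auto
qed

text \<open>The Laplace formula holds for \<open>Re z > 0\<close>. Integrability of the differenced
  kernel allows the limit \<open>z \<rightarrow> \<i> * \<omega>\<close> from the right.\<close>

lemma fdiff_pos_kernel_fourier:
  assumes "Re l > 0" "h \<ge> 0" "Re l < real K" "\<omega> \<noteq> 0"
  shows "(LINT u|lborel. fdiff h K (pos_kernel l) u * exp (- (\<i> * of_real \<omega>) * of_real u)) =
    (exp (- (\<i> * of_real \<omega>) * of_real h) - 1) ^ K * (Gamma l * (\<i> * of_real \<omega>) powr (- l))"
proof -
  let ?\<kappa> = "fdiff h K (pos_kernel l)"
  define z where "z i = complex_of_real (inverse (real (Suc i))) + \<i> * of_real \<omega>" for i
  have int: "integrable lborel ?\<kappa>"
    by (rule integrable_fdiff_pos_kernel[OF assms(1-3)])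
  have [measurable]: "?\<kappa> \<in> borel_measurable borel"
    using borel_measurable_integrable[OF int] by simp
  have z: "z \<longlonglongrightarrow> of_real 0 + \<i> * of_real \<omega>"
    unfolding z_def by (intro tendsto_intros LIMSEQ_inverse_real_of_nat)
  then have z: "z \<longlonglongrightarrow> \<i> * of_real \<omega>" by simp
  \<comment> \<open>The factor \<open>exp (- z i * u)\<close> has modulus at most 1 only for
    \<open>u \<ge> 0\<close>. The indicator enforces this and is removed afterwards, since the
    differenced kernel vanishes for \<open>u < 0\<close>.\<close>
  have "(\<lambda>i. LINT u|lborel. (?\<kappa> u * indicator {0..} u) * exp (- z i * of_real u)) \<longlonglongrightarrow>
     (LINT u|lborel. (?\<kappa> u * indicator {0..} u) * exp (- (\<i> * of_real \<omega>) * of_real u))"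
  proof (rule integral_dominated_convergence[where w = "\<lambda>u. norm (?\<kappa> u)"])
    show "AE u in lborel. (\<lambda>i. (?\<kappa> u * indicator {0..} u) * exp (- z i * of_real u)) \<longlonglongrightarrow>
       (?\<kappa> u * indicator {0..} u) * exp (- (\<i> * of_real \<omega>) * of_real u)"
      by (intro AE_I2 tendsto_intros z)
    show "AE u in lborel. norm ((?\<kappa> u * indicator {0..} u) * exp (- z i * of_real u)) \<le> norm (?\<kappa> u)" for i
      by (intro AE_I2) (auto simp: norm_mult indicator_def z_def intro!: mult_left_le)
  qed (use int in auto)
  moreover have "?\<kappa> u * indicator {0..} u = ?\<kappa> u" for u
  proof -
    have "u < 0 \<Longrightarrow> fdiff h K \<phi> u = 0" if "\<And>v. v < 0 \<Longrightarrow> \<phi> v = 0" for \<phi>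
      using that assms(2) by (induction K arbitrary: \<phi>) auto
    then show ?thesis by (auto simp: indicator_def pos_kernel_def)
  qed
  ultimately have "(\<lambda>i. LINT u|lborel. ?\<kappa> u * exp (- z i * of_real u)) \<longlonglongrightarrow>
     (LINT u|lborel. ?\<kappa> u * exp (- (\<i> * of_real \<omega>) * of_real u))"
    by simp
  moreover have "(LINT u|lborel. ?\<kappa> u * exp (- z i * of_real u)) =
      (exp (- z i * of_real h) - 1) ^ K * (Gamma l * z i powr (- l))" for i
  proof -
    have "Re (z i) > 0" by (simp add: z_def)
    then show ?thesis
      using fdiff_exp_integral_eq[OF integrable_pos_kernel_exp[OF assms(1)], of "z i"]
        laplace_pos_kernel[OF assms(1)] by simp
  qed
  \<comment> \<open>Since \<open>\<omega> \<noteq> 0\<close>, the limit point is off the branch cut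
    of \<open>powr\<close>, which is therefore continuous there.\<close>
  moreover have "(\<lambda>i. (exp (- z i * of_real h) - 1) ^ K * (Gamma l * z i powr (- l))) \<longlonglongrightarrow>
      (exp (- (\<i> * of_real \<omega>) * of_real h) - 1) ^ K * (Gamma l * (\<i> * of_real \<omega>) powr (- l))"
    using assms(4) by (intro tendsto_intros z) (auto simp: complex_nonpos_Reals_iff)
  ultimately show ?thesis
    using LIMSEQ_unique by auto
qed

section \<open>Fourier transforms\<close>

text \<open>Fubini, followed by a translation by \<open>c * u\<close> in the inner integral. The
  general measure \<open>N\<close> serves both the differenced kernel on \<open>lborel\<close> with
  \<open>c = 1\<close> and the polynomial on \<open>M\<close> with
  \<open>c = \<delta>\<close>.\<close>

lemma fourier_correlation:
  fixes f k :: "real \<Rightarrow> complex" and \<omega> c :: real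
  assumes N: "sigma_finite_measure N" "sets N = sets borel"
    and f: "integrable lborel f" and k: "integrable N k"
  shows integrable_correlation: "integrable lborel (\<lambda>x. LINT u|N. f (x + c * u) * k u)"
    and fourier_correlation_eq: "fourier (\<lambda>x. LINT u|N. f (x + c * u) * k u) \<omega> =
      fourier f \<omega> * (LINT u|N. k u * exp (- (\<i> * of_real \<omega>) * of_real (c * u)))"
proof -
  interpret N: sigma_finite_measure N by (rule N)
  interpret P: pair_sigma_finite N lborel ..
  note [measurable_cong] = N(2)
  have [measurable]: "f \<in> borel_measurable borel" "k \<in> borel_measurable N"
    using f k by (auto dest: borel_measurable_integrable)
  let ?F = "\<lambda>\<omega> u x. exp (\<i> * of_real (\<omega> * x)) * (f (x + c * u) * k u)"
  have shift: "integrable lborel (\<lambda>x. f (x + b))" "(LINT x|lborel. norm (f (x + b))) = (LINT x|lborel. norm (f x))" for b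
    using lborel_integrable_real_affine[OF f, of 1 b]
      lborel_integral_real_affine[of 1 "\<lambda>x. norm (f x)" b] by (simp_all add: add.commute)
  have int: "integrable (N \<Otimes>\<^sub>M lborel) (\<lambda>(u, x). ?F \<omega> u x)" for \<omega>
  proof (rule P.Fubini_integrable)
    show "(\<lambda>(u, x). ?F \<omega> u x) \<in> borel_measurable (N \<Otimes>\<^sub>M lborel)"
      by measurable
    show "integrable N (\<lambda>u. LINT x|lborel. norm (case (u, x) of (u, x) \<Rightarrow> ?F \<omega> u x))"
      using k by (simp add: norm_mult shift)
    show "AE u in N. integrable lborel (\<lambda>x. case (u, x) of (u, x) \<Rightarrow> ?F \<omega> u x)"
    proof (rule AE_I2)
      fix u
      show "integrable lborel (\<lambda>x. case (u, x) of (u, x) \<Rightarrow> ?F \<omega> u x)"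
        by (rule Bochner_Integration.integrable_bound[OF integrable_mult_left[OF shift(1)[of "c * u"], of "k u"]])
          (auto simp: norm_mult)
    qed
  qed
  \<comment> \<open>At frequency 0 the exponential is 1, so the double integrability already gives
    the claim.\<close>
  show "integrable lborel (\<lambda>x. LINT u|N. f (x + c * u) * k u)"
    using P.integrable_snd[OF int[of 0]] by simp
  let ?\<phi> = "\<lambda>x. exp (\<i> * of_real (\<omega> * x)) * f x"
  have "(LINT x|lborel. exp (\<i> * of_real (\<omega> * x)) * (LINT u|N. f (x + c * u) * k u)) =
      (LINT x|lborel. LINT u|N. ?F \<omega> u x)"
    by simp
  also have "\<dots> = (LINT u|N. LINT x|lborel. ?F \<omega> u x)"
    by (rule P.Fubini_integral[OF int])
  also have "\<dots> = (LINT u|N. (LINT x|lborel. ?\<phi> x) * (k u * exp (- (\<i> * of_real \<omega>) * of_real (c * u))))"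
  proof (rule Bochner_Integration.integral_cong[OF refl])
    fix u
    have "?F \<omega> u x = (k u * exp (- (\<i> * of_real \<omega>) * of_real (c * u))) * ?\<phi> (c * u + 1 * x)" for x
      by (simp add: exp_add[symmetric] algebra_simps)
    then have "(LINT x|lborel. ?F \<omega> u x) =
        (LINT x|lborel. (k u * exp (- (\<i> * of_real \<omega>) * of_real (c * u))) * ?\<phi> (c * u + 1 * x))"
      by (intro Bochner_Integration.integral_cong refl)
    also have "\<dots> = (k u * exp (- (\<i> * of_real \<omega>) * of_real (c * u))) * (LINT x|lborel. ?\<phi> (c * u + 1 * x))"
      by (rule integral_mult_right_zero)
    also have "(LINT x|lborel. ?\<phi> (c * u + 1 * x)) = (LINT x|lborel. ?\<phi> x)"
      using lborel_integral_real_affine[of 1 ?\<phi> "c * u"] by simp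
    finally show "(LINT x|lborel. ?F \<omega> u x) =
      (LINT x|lborel. ?\<phi> x) * (k u * exp (- (\<i> * of_real \<omega>) * of_real (c * u)))"
      by simp
  qed
  finally show "fourier (\<lambda>x. LINT u|N. f (x + c * u) * k u) \<omega> =
      fourier f \<omega> * (LINT u|N. k u * exp (- (\<i> * of_real \<omega>) * of_real (c * u)))"
    by (simp add: fourier_def)
qed

text \<open>The Fourier kernel has a positive sign in the exponent, so step \<open>- h\<close> here
  yields the same factor as step \<open>h\<close> for the differenced kernel.\<close>

lemma fourier_fdiff:
  assumes "integrable lborel g"
  shows "fourier (fdiff (- h) K g) \<omega> = (exp (- (\<i> * of_real \<omega>) * of_real h) - 1) ^ K * fourier g \<omega>"
proof -
  have [measurable]: "g \<in> borel_measurable borel"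
    using assms by (auto dest: borel_measurable_integrable)
  have "integrable lborel (\<lambda>u. g u * exp ((\<i> * of_real \<omega>) * of_real u))"
    using assms by (rule Bochner_Integration.integrable_bound) (auto simp: norm_mult)
  from fdiff_exp_integral_eq[OF this, of "- h" K] show ?thesis
    by (simp add: fourier_def mult_ac)
qed

section \<open>The transfer function\<close>

lemma weyl_integral_eq:
  "weyl_integral l f x = 1 / Gamma l * (LINT y|lborel. f y * pos_kernel l (y - x))"
  "set_integrable lborel {x<..} (weyl_integrand l f x) \<longleftrightarrow> integrable lborel (\<lambda>y. f y * pos_kernel l (y - x))"
proof -
  have "(\<lambda>y. indicator {x<..} y *\<^sub>R weyl_integrand l f x y) = (\<lambda>y. f y * pos_kernel l (y - x))"
    by (auto simp: weyl_integrand_def pos_kernel_def fun_eq_iff)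
  then show "weyl_integral l f x = 1 / Gamma l * (LINT y|lborel. f y * pos_kernel l (y - x))"
    "set_integrable lborel {x<..} (weyl_integrand l f x) \<longleftrightarrow> integrable lborel (\<lambda>y. f y * pos_kernel l (y - x))"
    by (simp_all add: weyl_integral_def set_lebesgue_integral_def set_integrable_def)
qed

text \<open>Here \<open>x\<close> enters only through the kernel, so differencing in
  \<open>x\<close> replaces \<open>pos_kernel l\<close> by its differences, which are integrable for
  large \<open>K\<close>.\<close>

lemma fdiff_weyl_integral:
  assumes "\<And>x. set_integrable lborel {x<..} (weyl_integrand l f x)"
  shows "fdiff (- h) K (weyl_integral l f) x =
    1 / Gamma l * (LINT u|lborel. f (x + u) * fdiff h K (pos_kernel l) u)"
proof -
  have "fdiff (- h) K (weyl_integral l f) x =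
      fdiff (- h) K (\<lambda>x. (LINT y|lborel. f y * pos_kernel l (y - x)) * (1 / Gamma l)) x"
    by (simp add: weyl_integral_eq(1)[abs_def] mult.commute)
  also have "\<dots> = 1 / Gamma l * (LINT y|lborel. fdiff (- h) K (\<lambda>x. f y * pos_kernel l (y - x)) x)"
    unfolding fdiff_mult_right
    using fdiff_integral_eq[of lborel "\<lambda>x y. f y * pos_kernel l (y - x)"] assms
    by (simp add: weyl_integral_eq(2))
  also have "(\<lambda>y. fdiff (- h) K (\<lambda>x. f y * pos_kernel l (y - x)) x) =
      (\<lambda>y. f y * fdiff h K (pos_kernel l) (y - x))"
    by (simp add: fdiff_mult_left fdiff_reflect[of h K "pos_kernel l"])
  also have "(LINT y|lborel. f y * fdiff h K (pos_kernel l) (y - x)) =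
      (LINT u|lborel. f (x + u) * fdiff h K (pos_kernel l) u)"
    using lborel_integral_real_affine[of 1 "\<lambda>y. f y * fdiff h K (pos_kernel l) (y - x)" x] by simp
  finally show ?thesis .
qed

lemma fdiff_orth_deriv:
  assumes "\<And>x. integrable M (\<lambda>\<xi>. f (x + \<delta> * \<xi>) * of_real (poly p \<xi>))"
  shows "fdiff h K (orth_deriv M p n \<delta> f) x = orth_deriv M p n \<delta> (fdiff h K f) x"
proof -
  let ?C = "complex_of_real (lead_coeff p * fact n / poly_norm_sq M p * (1 / \<delta> ^ n))"
  have "fdiff h K (orth_deriv M p n \<delta> f) x =
      fdiff h K (\<lambda>x. (LINT \<xi>|M. f (x + \<delta> * \<xi>) * of_real (poly p \<xi>)) * ?C) x"
    by (simp add: orth_deriv_def[abs_def] mult.commute)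
  also have "\<dots> = ?C * (LINT \<xi>|M. fdiff h K (\<lambda>x. f (x + \<delta> * \<xi>) * of_real (poly p \<xi>)) x)"
    unfolding fdiff_mult_right
    using fdiff_integral_eq[of M "\<lambda>x \<xi>. f (x + \<delta> * \<xi>) * of_real (poly p \<xi>)"] assms
    by (simp add: fdiff_mult_right)
  finally show ?thesis
    by (simp add: orth_deriv_def fdiff_mult_right fdiff_translate[of h K f])
qed

section \<open>Polynomials under a measure with finite moments and their exponential
  integrals\<close>

lemma finite_moments_finite_measure:
  assumes "finite_moments M"
  shows "finite_measure M"
proof
  have "integrable M (\<lambda>x. 1 :: real)"
    using assms[unfolded finite_moments_def, rule_format, of 0] by simp
  then show "emeasure M (space M) \<noteq> \<infinity>"
    by (simp add: integrable_iff_bounded)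
qed

lemma finite_moments_integrable_poly:
  assumes "finite_moments M"
  shows "integrable M (poly q)"
  using assms unfolding finite_moments_def poly_altdef by auto

lemma fourier_orth_deriv:
  assumes "sets M = sets borel" "finite_moments M" "integrable lborel f"
  shows "fourier (orth_deriv M p n \<delta> f) \<omega> =
    of_real (lead_coeff p * fact n / poly_norm_sq M p * (1 / \<delta> ^ n)) * fourier f \<omega> *
    (LINT \<xi>|M. of_real (poly p \<xi>) * exp (- (\<i> * of_real \<omega>) * of_real (\<delta> * \<xi>)))"
proof -
  have M: "sigma_finite_measure M"
    using finite_moments_finite_measure[OF assms(2)] by (simp add: finite_measure.axioms(1))
  have p: "integrable M (\<lambda>\<xi>. complex_of_real (poly p \<xi>))"
    using finite_moments_integrable_poly[OF assms(2)] by simp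
  have scale: "fourier (\<lambda>x. a * \<phi> x) \<omega> = a * fourier \<phi> \<omega>" for a \<phi>
    by (simp add: fourier_def mult.left_commute[of _ a])
  show ?thesis
    unfolding orth_deriv_def[abs_def] scale fourier_correlation_eq[OF M assms(1,3) p] by simp
qed

lemma exp_remainder_series:
  fixes z :: complex
  shows "z ^ n * (\<Sum>k. z ^ k / fact (k + n)) = exp z - (\<Sum>k<n. z ^ k / fact k)"
proof -
  have exp: "(\<lambda>k. z ^ k / fact k) sums exp z"
    using exp_converges[of z] by (simp add: scaleR_conv_of_real divide_inverse mult.commute)
  then have "(\<lambda>k. z ^ (k + n) / fact (k + n)) sums (exp z - (\<Sum>k<n. z ^ k / fact k))"
    by (rule sums_split_initial_segment)
  then have s: "(\<lambda>k. z ^ n * (z ^ k / fact (k + n))) sums (exp z - (\<Sum>k<n. z ^ k / fact k))"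
    by (simp add: power_add mult.commute)
  show ?thesis
  \<comment> \<open>Summability is obtained by cancelling \<open>z ^ n\<close>, which needs
    \<open>z \<noteq> 0\<close>. At 0 both sides vanish for \<open>n > 0\<close>, while for
    \<open>n = 0\<close> the factor \<open>z ^ n\<close> is 1.\<close>
  proof (cases "z = 0")
    case True
    then show ?thesis
    proof (cases n)
      case (Suc m)
      then show ?thesis using True by (simp add: lessThan_Suc_eq_insert_0 sum.reindex zero_notin_Suc_image)
    next
      case 0
      then show ?thesis using s True by (simp add: sums_iff)
    qed
  next
    case False
    then have "summable (\<lambda>k. z ^ k / fact (k + n))"
      using sums_summable[OF s] by (simp only: summable_cmult_iff) auto
    from suminf_mult[OF this, of "z ^ n"] show ?thesis
      using s by (simp add: sums_iff)
  qed
qed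

text \<open>Orthogonality kills the first \<open>n\<close> Taylor terms of the exponential. Only
  this finite head is integrated term by term; the remainder stays under the integral as one
  function, so no infinite sum is interchanged with the integral.\<close>

lemma orthogonal_poly_exp_integral:
  assumes M: "sets M = sets borel" "finite_moments M" and p: "orthogonal_poly M n p"
    and "Re z = 0"
  shows "(LINT \<xi>|M. of_real (poly p \<xi>) * exp (z * of_real \<xi>)) =
    z ^ n * (LINT \<xi>|M. of_real (poly p \<xi>) * of_real (\<xi> ^ n) * (\<Sum>k. (z * of_real \<xi>) ^ k / fact (k + n)))"
proof -
  note [measurable_cong] = M(1)
  have mono: "integrable M (\<lambda>\<xi>. complex_of_real (poly p \<xi> * \<xi> ^ k))" for k
  proof -
    have "(\<lambda>\<xi>. poly p \<xi> * \<xi> ^ k) = poly (p * monom 1 k)"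
      by (simp add: fun_eq_iff poly_monom)
    then show ?thesis
      using finite_moments_integrable_poly[OF M(2)] by (metis complex_of_real_integrable_eq)
  qed
  have orth: "(LINT \<xi>|M. complex_of_real (poly p \<xi> * \<xi> ^ k)) = 0" if "k < n" for k
  proof -
    have "(LINT \<xi>|M. poly p \<xi> * poly (monom 1 k) \<xi>) = 0"
      using p that unfolding orthogonal_poly_def by (simp add: degree_monom_eq)
    then show ?thesis
      unfolding integral_complex_of_real by (simp add: poly_monom)
  qed
  have [measurable]: "poly p \<in> borel_measurable M"
    using finite_moments_integrable_poly[OF M(2)] by (rule borel_measurable_integrable)
  \<comment> \<open>For imaginary \<open>z\<close> the exponential is unimodular, so the polynomial
    itself is a bound.\<close>
  have int: "integrable M (\<lambda>\<xi>. of_real (poly p \<xi>) * exp (z * of_real \<xi>))"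
    by (rule Bochner_Integration.integrable_bound[OF mono[of 0]])
      (use \<open>Re z = 0\<close> in \<open>auto simp: norm_mult\<close>)
  have "of_real (poly p \<xi>) * exp (z * of_real \<xi>) =
      (\<Sum>k<n. z ^ k / fact k * complex_of_real (poly p \<xi> * \<xi> ^ k)) +
      z ^ n * (of_real (poly p \<xi>) * of_real (\<xi> ^ n) * (\<Sum>k. (z * of_real \<xi>) ^ k / fact (k + n)))" for \<xi>
  proof -
    have "z ^ n * (of_real (poly p \<xi>) * of_real (\<xi> ^ n) * (\<Sum>k. (z * of_real \<xi>) ^ k / fact (k + n))) =
        of_real (poly p \<xi>) * ((z * of_real \<xi>) ^ n * (\<Sum>k. (z * of_real \<xi>) ^ k / fact (k + n)))"
      by (simp add: power_mult_distrib)
    then show ?thesis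
      unfolding exp_remainder_series by (simp add: right_diff_distrib sum_distrib_left power_mult_distrib mult_ac)
  qed
  then have eq: "z ^ n * (of_real (poly p \<xi>) * of_real (\<xi> ^ n) * (\<Sum>k. (z * of_real \<xi>) ^ k / fact (k + n))) =
      of_real (poly p \<xi>) * exp (z * of_real \<xi>) -
      (\<Sum>k<n. z ^ k / fact k * complex_of_real (poly p \<xi> * \<xi> ^ k))" for \<xi>
    by simp
  have "(\<Sum>k<n. z ^ k / fact k * (LINT \<xi>|M. complex_of_real (poly p \<xi> * \<xi> ^ k))) = 0"
  proof (rule sum.neutral, rule ballI)
    fix k assume "k \<in> {..<n}"
    then show "z ^ k / fact k * (LINT \<xi>|M. complex_of_real (poly p \<xi> * \<xi> ^ k)) = 0"
      using orth[of k] by (simp only: lessThan_iff mult_zero_right)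
  qed
  then have "(LINT \<xi>|M. of_real (poly p \<xi>) * exp (z * of_real \<xi>)) =
     (LINT \<xi>|M. of_real (poly p \<xi>) * exp (z * of_real \<xi>)) -
      (\<Sum>k<n. z ^ k / fact k * (LINT \<xi>|M. complex_of_real (poly p \<xi> * \<xi> ^ k)))"
    by (simp only: diff_0_right)
  also have "\<dots> = (LINT \<xi>|M. of_real (poly p \<xi>) * exp (z * of_real \<xi>) -
      (\<Sum>k<n. z ^ k / fact k * complex_of_real (poly p \<xi> * \<xi> ^ k)))"
    using int mono by (subst Bochner_Integration.integral_diff) (auto simp: integral_sum)
  finally show ?thesis
    unfolding eq[symmetric] by simp
qed

section \<open>Cancelling the differences and comparing the two forms of the transfer
  function\<close>

theorem theorem5p1:
  fixes n :: nat and \<delta> \<epsilon> :: real and \<nu> :: complex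
    and M :: "real measure" and p :: "real poly" and f g :: "real \<Rightarrow> complex"
  assumes "n > 0" and "\<delta> > 0" and "Re \<nu> < real n"
    and "sets M = sets borel" and "finite_moments M"
    and "\<exists>S. finite S \<and> card S = n + 1 \<and> S \<subseteq> measure_support M"
    and "orthogonal_poly M n p"
    and "continuous_on UNIV f" and "integrable lborel f"
    and "\<epsilon> > 0" and "f \<in> O[at_top](\<lambda>x. of_real (x powr (Re \<nu> - real n - \<epsilon>)))"
    and "frac_orth_deriv_converges M p n \<delta> \<nu> f"
    and "g = frac_orth_deriv M p n \<delta> \<nu> f"
    and "integrable lborel g"
  shows "\<forall>\<omega>::real. \<omega> \<noteq> 0 \<longrightarrow>
    (let H = of_real (lead_coeff p * fact n / (poly_norm_sq M p * \<delta> ^ n)) * (-1) ^ n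
             * (\<i> * of_real \<omega>) powr (\<nu> - of_nat n)
             * (LINT \<xi>|M. of_real (poly p \<xi>) * exp (- \<i> * of_real (\<omega> * \<delta> * \<xi>)))
     in fourier g \<omega> = H * fourier f \<omega> \<and>
        H = of_real (lead_coeff p * fact n / poly_norm_sq M p)
             * (\<i> * of_real \<omega>) powr \<nu>
             * (LINT \<xi>|M. of_real (poly p \<xi>) * of_real (\<xi> ^ n)
                  * (\<Sum>k. (- \<i> * of_real (\<omega> * \<delta> * \<xi>)) ^ k / fact (k + n))))"
proof (intro allI impI)
  fix \<omega> :: real assume \<omega>: "\<omega> \<noteq> 0"
  define l where "l = of_nat n - \<nu>"
  have l: "Re l > 0" using assms(3) by (simp add: l_def)
  then have Gl: "Gamma l \<noteq> 0"
    by (auto simp: Gamma_eq_zero_iff elim!: nonpos_Ints_cases)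
  define h where "h = pi / \<bar>\<omega>\<bar>"
  have h: "h \<ge> 0" by (simp add: h_def)
  obtain K :: nat where K: "Re l < real K" using reals_Archimedean2 by blast
  define E where "E = exp (- (\<i> * of_real \<omega>) * of_real h) - 1"
  \<comment> \<open>For either sign of \<open>\<omega>\<close> the product
    \<open>\<omega> * h\<close> is an odd multiple of \<open>pi\<close>.\<close>
  have "exp (- (\<i> * of_real \<omega>) * of_real h) = - 1"
    using \<omega> by (cases "\<omega> > 0") (auto simp: h_def exp_minus exp_pi_i' exp_pi_i)
  then have E: "E ^ K \<noteq> 0" by (simp add: E_def)
  define \<kappa> where "\<kappa> = fdiff h K (pos_kernel l)"
  have \<kappa>: "integrable lborel \<kappa>"
    unfolding \<kappa>_def by (rule integrable_fdiff_pos_kernel[OF l h K])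
  have conv: "set_integrable lborel {x<..} (weyl_integrand l f x)"
    "integrable M (\<lambda>\<xi>. weyl_integral l f (x + \<delta> * \<xi>) * of_real (poly p \<xi>))" for x
    using assms(12) by (auto simp: frac_orth_deriv_converges_def l_def)
  let ?V = "fdiff (- h) K (weyl_integral l f)"
  let ?J = "LINT \<xi>|M. of_real (poly p \<xi>) * exp (- \<i> * of_real (\<omega> * \<delta> * \<xi>))"
  let ?c = "complex_of_real (lead_coeff p * fact n / (poly_norm_sq M p * \<delta> ^ n))"
  have V: "?V = (\<lambda>x. LINT u|lborel. f (x + 1 * u) * (1 / Gamma l * \<kappa> u))"
    by (auto simp: fun_eq_iff fdiff_weyl_integral[OF conv(1)] \<kappa>_def)
  \<comment> \<open>This is the gain from differencing: \<open>?V\<close> has a Fourier transform as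
    an integrable function.\<close>
  have V_int: "integrable lborel ?V"
    unfolding V using \<kappa> by (intro integrable_correlation sigma_finite_lborel assms(9)) auto
  have "fourier ?V \<omega> = fourier f \<omega> * (LINT u|lborel. 1 / Gamma l * \<kappa> u * exp (- (\<i> * of_real \<omega>) * of_real (1 * u)))"
    unfolding V using \<kappa> by (intro fourier_correlation_eq sigma_finite_lborel assms(9)) auto
  also have "(LINT u|lborel. 1 / Gamma l * \<kappa> u * exp (- (\<i> * of_real \<omega>) * of_real (1 * u))) =
      1 / Gamma l * (LINT u|lborel. \<kappa> u * exp (- (\<i> * of_real \<omega>) * of_real u))"
    by (simp add: mult.assoc)
  also have "\<dots> = E ^ K * (\<i> * of_real \<omega>) powr (- l)"
    using fdiff_pos_kernel_fourier[OF l h K \<omega>] Gl by (simp add: \<kappa>_def E_def)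
  finally have V_fourier: "fourier ?V \<omega> = fourier f \<omega> * (E ^ K * (\<i> * of_real \<omega>) powr (- l))" .
  have g: "g = (\<lambda>x. orth_deriv M p n \<delta> (weyl_integral l f) x * (- 1) ^ n)"
    unfolding assms(13) by (simp add: frac_orth_deriv_def fun_eq_iff l_def)
  have "fdiff (- h) K g = (\<lambda>x. (- 1) ^ n * orth_deriv M p n \<delta> ?V x)"
    unfolding g by (simp add: fun_eq_iff fdiff_mult_right fdiff_orth_deriv[OF conv(2)])
  \<comment> \<open>The transform of the differenced \<open>g\<close> is computed twice: from
    integrability of \<open>g\<close> on the left, and through \<open>?V\<close> on the
    right.\<close>
  then have "E ^ K * fourier g \<omega> = fourier (\<lambda>x. (- 1) ^ n * orth_deriv M p n \<delta> ?V x) \<omega>"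
    using fourier_fdiff[OF assms(14), of h K \<omega>] by (simp add: E_def)
  also have "\<dots> = (- 1) ^ n * fourier (orth_deriv M p n \<delta> ?V) \<omega>"
    by (simp add: fourier_def mult.left_commute[of _ "(- 1) ^ n"])
  also have "\<dots> = (- 1) ^ n * (?c * fourier ?V \<omega> * ?J)"
    by (simp add: fourier_orth_deriv[OF assms(4,5) V_int] mult_ac)
  finally have "E ^ K * fourier g \<omega> =
      E ^ K * (?c * (- 1) ^ n * (\<i> * of_real \<omega>) powr (\<nu> - of_nat n) * ?J * fourier f \<omega>)"
    unfolding V_fourier by (simp add: l_def mult_ac)
  then have 1: "fourier g \<omega> = ?c * (- 1) ^ n * (\<i> * of_real \<omega>) powr (\<nu> - of_nat n) * ?J * fourier f \<omega>"
    using E by (simp only: mult_cancel_left) simp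
  let ?z = "- \<i> * of_real (\<omega> * \<delta>)"
  let ?S = "LINT \<xi>|M. of_real (poly p \<xi>) * of_real (\<xi> ^ n)
                  * (\<Sum>k. (- \<i> * of_real (\<omega> * \<delta> * \<xi>)) ^ k / fact (k + n))"
  have J: "?J = ?z ^ n * ?S"
    using orthogonal_poly_exp_integral[OF assms(4,5,7), of ?z] by (simp add: mult.assoc)
  \<comment> \<open>The sign \<open>(- 1) ^ n\<close> turns \<open>- \<i>\<close> back into
    \<open>\<i>\<close>, and \<open>\<delta> ^ n\<close> splits off to cancel the
    denominator.\<close>
  have "(- 1) ^ n * ?z ^ n = (\<i> * of_real \<omega>) ^ n * of_real (\<delta> ^ n)"
    unfolding power_mult_distrib[symmetric] of_real_power by (simp add: mult.assoc)
  \<comment> \<open>An integer power of a nonzero base merges with \<open>powr\<close> whatever the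
    branch.\<close>
  moreover have "(\<i> * of_real \<omega>) powr (\<nu> - of_nat n) * (\<i> * of_real \<omega>) ^ n = (\<i> * of_real \<omega>) powr \<nu>"
    using \<omega> by (simp add: powr_diff powr_nat')
  ultimately have z: "(- 1) ^ n * (\<i> * of_real \<omega>) powr (\<nu> - of_nat n) * ?z ^ n =
      (\<i> * of_real \<omega>) powr \<nu> * of_real (\<delta> ^ n)"
    by (metis mult.assoc mult.commute)
  have "?c * (- 1) ^ n * (\<i> * of_real \<omega>) powr (\<nu> - of_nat n) * ?J =
      ?c * ((- 1) ^ n * (\<i> * of_real \<omega>) powr (\<nu> - of_nat n) * ?z ^ n) * ?S"
    unfolding J by (simp only: mult.assoc)
  also have "\<dots> = ?c * ((\<i> * of_real \<omega>) powr \<nu> * of_real (\<delta> ^ n)) * ?S"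
    by (simp only: z)
  also have "\<dots> = of_real (lead_coeff p * fact n / poly_norm_sq M p) * (\<i> * of_real \<omega>) powr \<nu> * ?S"
    using assms(2) by simp
  finally show "let H = of_real (lead_coeff p * fact n / (poly_norm_sq M p * \<delta> ^ n)) * (-1) ^ n
             * (\<i> * of_real \<omega>) powr (\<nu> - of_nat n)
             * (LINT \<xi>|M. of_real (poly p \<xi>) * exp (- \<i> * of_real (\<omega> * \<delta> * \<xi>)))
     in fourier g \<omega> = H * fourier f \<omega> \<and>
        H = of_real (lead_coeff p * fact n / poly_norm_sq M p)
             * (\<i> * of_real \<omega>) powr \<nu>
             * (LINT \<xi>|M. of_real (poly p \<xi>) * of_real (\<xi> ^ n)
                  * (\<Sum>k. (- \<i> * of_real (\<omega> * \<delta> * \<xi>)) ^ k / fact (k + n)))"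
    using 1 unfolding Let_def by blast
qed

end
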